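(* The modal systems $\mathsf{K}_n\mathbf{DPC}$, $\mathsf{D}_n\mathbf{DPC}$ and $\mathsf{T}_n\mathbf{DPC}$ have the uniform interpolation property.
   Context: Fix a finite nonempty set $\mathcal{A}$ of $n$ agents and a countable set $\mathcal{P}$ of atoms; $\mathcal{P}^+(X)$ is the set of nonempty subsets of $X$. The language $\mathcal{L}^{\mathbf D}_{\mathbf{PC}}$ is generated by $\phi ::= p \mid \neg\phi \mid \phi\wedge\phi \mid \phi\vee\phi \mid \mathbf{K}_i\phi \mid \mathbf{D}_{\mathcal{B}}\phi \mid \mathbf{C}\psi$ where $p\in\mathcal P$, $i\in\mathcal A$, $\mathcal B\in\mathcal P^+(\mathcal A)$ and $\psi$ is a propositional (modality-free) formula. A model is $M=(S,R,V)$, $S\neq\emptyset$, $R_i\subseteq S\times S$ for $i\in\mathcal A$, $V:S\to 2^{\mathcal P}$; $R_{\mathcal B}=\bigcap_{i\in\mathcal B}R_i$. Truth: $M,s\models\mathbf{K}_i\phi$ iff $\phi$ holds at all $R_i$-successors of $s$; $M,s\models\mathbf{D}_{\mathcal B}\phi$ iff $\phi$ holds at all $R_{\mathcal B}$-successors of $s$; $M,s\models\mathbf{C}\psi$ iff $\psi$ holds at every world reachable from $s$ in one or more steps along $\bigcup_{i\in\mathcal A}R_i$; atoms and Booleans as usual. A $\mathsf K_n\mathbf{DPC}$-model is any model, a $\mathsf D_n\mathbf{DPC}$-model one in which every $R_i$ is serial, a $\mathsf T_n\mathbf{DPC}$-model one in which every $R_i$ is reflexive. For such a system $\mathsf L$,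 $\mathsf L$-satisfiability and $\models_{\mathsf L}$ are defined relative to its class of models. A formula is over $P$ if all its atoms lie in $P$. $\mathsf L$ has the uniform interpolation property if for every finite $P\subseteq\mathcal P$, every $\mathsf L$-satisfiable $\phi\in\mathcal{L}^{\mathbf D}_{\mathbf{PC}}$ over $P$ and every $p\in P$ there is an $\mathsf L$-satisfiable $\psi\in\mathcal{L}^{\mathbf D}_{\mathbf{PC}}$ over $P\setminus\{p\}$ such that for every formula $\chi$ not containing $p$: $\phi\models_{\mathsf L}\chi$ iff $\psi\models_{\mathsf L}\chi$.
   Formalization: The language gets a primitive tautology ⊤: without it no formula over the empty set exists, so the claim fails for P={p}, φ=p (for P∖{p} nonempty ⊤ is eliminable). Models have worlds in a fixed arbitrary infinite set, which by Löwenheim–Skolem changes neither satisfiability nor entailment. *)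

theory Defs
  imports Main "HOL-Library.Countable_Set"
begin

typedef 'a coalition = "{B :: 'a set. B \<noteq> {}}"
  morphisms members Coalition
  by blast

text \<open>The tautology is a primitive here. The abbreviation \<open>q \<or> \<not> q\<close> would need an atom, so that
  there would be no formula at all over the empty set of atoms, and uniform interpolation would fail
  outright for \<open>P = {p}\<close>. Whenever \<open>P - {p}\<close> is nonempty the primitive is redundant; see
  \<open>uniform_interpolation_top_free\<close> below.\<close>

datatype 'p pfm =
    PTop
  | PAtom 'p
  | PNeg "'p pfm"
  | PAnd "'p pfm" "'p pfm"
  | POr "'p pfm" "'p pfm"

datatype ('a, 'p) fm =
    Top
  | Atom 'p
  | Neg "('a, 'p) fm"
  | And "('a, 'p) fm" "('a, 'p) fm"
  | Or "('a, 'p) fm" "('a, 'p) fm"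
  | Know 'a "('a, 'p) fm"
  | Dist "'a coalition" "('a, 'p) fm"
  | Common "'p pfm"

primrec atoms_prop :: "'p pfm \<Rightarrow> 'p set" where
  "atoms_prop PTop = {}"
| "atoms_prop (PAtom p) = {p}"
| "atoms_prop (PNeg f) = atoms_prop f"
| "atoms_prop (PAnd f g) = atoms_prop f \<union> atoms_prop g"
| "atoms_prop (POr f g) = atoms_prop f \<union> atoms_prop g"

primrec atoms :: "('a, 'p) fm \<Rightarrow> 'p set" where
  "atoms Top = {}"
| "atoms (Atom p) = {p}"
| "atoms (Neg f) = atoms f"
| "atoms (And f g) = atoms f \<union> atoms g"
| "atoms (Or f g) = atoms f \<union> atoms g"
| "atoms (Know i f) = atoms f"
| "atoms (Dist B f) = atoms f"
| "atoms (Common f) = atoms_prop f"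

record ('s, 'a, 'p) model =
  worlds :: "'s set"
  rel :: "'a \<Rightarrow> ('s \<times> 's) set"
  val :: "'s \<Rightarrow> 'p set"

definition is_model :: "('s, 'a, 'p) model \<Rightarrow> bool" where
  "is_model M \<longleftrightarrow> worlds M \<noteq> {} \<and> (\<forall>i. rel M i \<subseteq> worlds M \<times> worlds M)"

definition rel_D :: "('s, 'a, 'p) model \<Rightarrow> 'a coalition \<Rightarrow> ('s \<times> 's) set" where
  "rel_D M B = (\<Inter>i\<in>members B. rel M i)"

primrec sat_prop :: "'p set \<Rightarrow> 'p pfm \<Rightarrow> bool" where
  "sat_prop X PTop \<longleftrightarrow> True"
| "sat_prop X (PAtom p) \<longleftrightarrow> p \<in> X"
| "sat_prop X (PNeg f) \<longleftrightarrow> \<not> sat_prop X f"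
| "sat_prop X (PAnd f g) \<longleftrightarrow> sat_prop X f \<and> sat_prop X g"
| "sat_prop X (POr f g) \<longleftrightarrow> sat_prop X f \<or> sat_prop X g"

primrec sat :: "('s, 'a, 'p) model \<Rightarrow> 's \<Rightarrow> ('a, 'p) fm \<Rightarrow> bool" where
  "sat M s Top \<longleftrightarrow> True"
| "sat M s (Atom p) \<longleftrightarrow> p \<in> val M s"
| "sat M s (Neg f) \<longleftrightarrow> \<not> sat M s f"
| "sat M s (And f g) \<longleftrightarrow> sat M s f \<and> sat M s g"
| "sat M s (Or f g) \<longleftrightarrow> sat M s f \<or> sat M s g"
| "sat M s (Know i f) \<longleftrightarrow> (\<forall>t. (s, t) \<in> rel M i \<longrightarrow> sat M t f)"
| "sat M s (Dist B f) \<longleftrightarrow> (\<forall>t. (s, t) \<in> rel_D M B \<longrightarrow> sat M t f)"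
| "sat M s (Common f) \<longleftrightarrow> (\<forall>t. (s, t) \<in> (\<Union>i. rel M i)\<^sup>+ \<longrightarrow> sat_prop (val M t) f)"

text \<open>A system is identified with its class of models, the worlds being drawn from the type \<open>'s\<close>.
  The lemmas \<open>satisfiable_world_type\<close> and \<open>entails_world_type\<close> below show that the choice of an
  infinite \<open>'s\<close> is immaterial.\<close>

definition KnDPC :: "('s, 'a, 'p) model set" where
  "KnDPC = {M. is_model M}"

definition DnDPC :: "('s, 'a, 'p) model set" where
  "DnDPC = {M. is_model M \<and> (\<forall>i. \<forall>s\<in>worlds M. \<exists>t. (s, t) \<in> rel M i)}"

definition TnDPC :: "('s, 'a, 'p) model set" where
  "TnDPC = {M. is_model M \<and> (\<forall>i. refl_on (worlds M) (rel M i))}"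

definition satisfiable :: "('s, 'a, 'p) model set \<Rightarrow> ('a, 'p) fm \<Rightarrow> bool" where
  "satisfiable L f \<longleftrightarrow> (\<exists>M\<in>L. \<exists>s\<in>worlds M. sat M s f)"

definition entails :: "('s, 'a, 'p) model set \<Rightarrow> ('a, 'p) fm \<Rightarrow> ('a, 'p) fm \<Rightarrow> bool" where
  "entails L f g \<longleftrightarrow> (\<forall>M\<in>L. \<forall>s\<in>worlds M. sat M s f \<longrightarrow> sat M s g)"

definition uniform_interpolation :: "('s, 'a, 'p) model set \<Rightarrow> bool" where
  "uniform_interpolation L \<longleftrightarrow>
    (\<forall>P f p. finite P \<and> satisfiable L f \<and> atoms f \<subseteq> P \<and> p \<in> P \<longrightarrow>
      (\<exists>g. satisfiable L g \<and> atoms g \<subseteq> P - {p} \<and>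
        (\<forall>h. p \<notin> atoms h \<longrightarrow> (entails L f h \<longleftrightarrow> entails L g h))))"

text \<open>Relative to an atom \<open>q\<close>, the tautology can be eliminated.\<close>

primrec top_free_prop :: "'p pfm \<Rightarrow> bool" where
  "top_free_prop PTop \<longleftrightarrow> False"
| "top_free_prop (PAtom p) \<longleftrightarrow> True"
| "top_free_prop (PNeg f) \<longleftrightarrow> top_free_prop f"
| "top_free_prop (PAnd f g) \<longleftrightarrow> top_free_prop f \<and> top_free_prop g"
| "top_free_prop (POr f g) \<longleftrightarrow> top_free_prop f \<and> top_free_prop g"

primrec top_free :: "('a, 'p) fm \<Rightarrow> bool" where
  "top_free Top \<longleftrightarrow> False"
| "top_free (Atom p) \<longleftrightarrow> True"
| "top_free (Neg f) \<longleftrightarrow> top_free f"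
| "top_free (And f g) \<longleftrightarrow> top_free f \<and> top_free g"
| "top_free (Or f g) \<longleftrightarrow> top_free f \<and> top_free g"
| "top_free (Know i f) \<longleftrightarrow> top_free f"
| "top_free (Dist B f) \<longleftrightarrow> top_free f"
| "top_free (Common f) \<longleftrightarrow> top_free_prop f"

primrec elim_top_prop :: "'p \<Rightarrow> 'p pfm \<Rightarrow> 'p pfm" where
  "elim_top_prop q PTop = POr (PAtom q) (PNeg (PAtom q))"
| "elim_top_prop q (PAtom p) = PAtom p"
| "elim_top_prop q (PNeg f) = PNeg (elim_top_prop q f)"
| "elim_top_prop q (PAnd f g) = PAnd (elim_top_prop q f) (elim_top_prop q g)"
| "elim_top_prop q (POr f g) = POr (elim_top_prop q f) (elim_top_prop q g)"

primrec elim_top :: "'p \<Rightarrow> ('a, 'p) fm \<Rightarrow> ('a, 'p) fm" where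
  "elim_top q Top = Or (Atom q) (Neg (Atom q))"
| "elim_top q (Atom p) = Atom p"
| "elim_top q (Neg f) = Neg (elim_top q f)"
| "elim_top q (And f g) = And (elim_top q f) (elim_top q g)"
| "elim_top q (Or f g) = Or (elim_top q f) (elim_top q g)"
| "elim_top q (Know i f) = Know i (elim_top q f)"
| "elim_top q (Dist B f) = Dist B (elim_top q f)"
| "elim_top q (Common f) = Common (elim_top_prop q f)"

lemma elim_top_prop:
  "top_free_prop (elim_top_prop q f)" "atoms_prop (elim_top_prop q f) \<subseteq> insert q (atoms_prop f)"
  "sat_prop X (elim_top_prop q f) \<longleftrightarrow> sat_prop X f"
  by (induction f) auto

lemma elim_top:
  "top_free (elim_top q f)" "atoms (elim_top q f) \<subseteq> insert q (atoms f)"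
  "sat M s (elim_top q f) \<longleftrightarrow> sat M s f"
proof -
  show "top_free (elim_top q f)"
    by (induction f) (auto simp: elim_top_prop)
  show "atoms (elim_top q f) \<subseteq> insert q (atoms f)"
    by (induction f) (auto dest: subsetD[OF elim_top_prop(2)])
  show "sat M s (elim_top q f) \<longleftrightarrow> sat M s f"
    by (induction f arbitrary: s) (auto simp: elim_top_prop)
qed

lemma uniform_interpolation_top_free:
  assumes "uniform_interpolation L"
    and "finite P" "satisfiable L f" "top_free f" "atoms f \<subseteq> P" "p \<in> P" "P - {p} \<noteq> {}"
  shows "\<exists>g. satisfiable L g \<and> top_free g \<and> atoms g \<subseteq> P - {p} \<and>
    (\<forall>h. top_free h \<and> p \<notin> atoms h \<longrightarrow> (entails L f h \<longleftrightarrow> entails L g h))"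
proof -
  obtain q where q: "q \<in> P - {p}"
    using assms(7) by blast
  obtain g where g: "satisfiable L g" "atoms g \<subseteq> P - {p}"
    "\<And>h. p \<notin> atoms h \<Longrightarrow> entails L f h \<longleftrightarrow> entails L g h"
    using assms(1)[unfolded uniform_interpolation_def, rule_format, of P f p] assms(2-6) by auto
  have "satisfiable L (elim_top q g)"
    using g(1) by (simp add: satisfiable_def elim_top(3))
  moreover have e: "entails L (elim_top q g) h \<longleftrightarrow> entails L g h" for h
    by (simp add: entails_def elim_top(3))
  moreover have "atoms (elim_top q g) \<subseteq> P - {p}"
    using elim_top(2)[of q g] g(2) q by blast
  ultimately show ?thesis
    using g(3) elim_top(1) by (intro exI[of _ "elim_top q g"]) simp
qed

text \<open>Downward Loewenheim-Skolem: a formula satisfiable over any world type at all is satisfiable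
  over every infinite world type.\<close>

instance coalition :: (finite) finite
proof
  have "inj (members :: 'a coalition \<Rightarrow> 'a set)"
    by (simp add: inj_on_def members_inject)
  moreover have "finite (range (members :: 'a coalition \<Rightarrow> 'a set))"
    by simp
  ultimately show "finite (UNIV :: 'a coalition set)"
    by (rule finite_imageD[rotated])
qed

instance pfm :: (countable) countable
  by countable_datatype

primrec fm_code :: "('a :: finite, 'p :: countable) fm \<Rightarrow> nat" where
  "fm_code (Atom p) = to_nat (0 :: nat, to_nat p)"
| "fm_code (Neg f) = to_nat (1 :: nat, fm_code f)"
| "fm_code (And f g) = to_nat (2 :: nat, to_nat (fm_code f, fm_code g))"
| "fm_code (Or f g) = to_nat (3 :: nat, to_nat (fm_code f, fm_code g))"
| "fm_code (Know i f) = to_nat (4 :: nat, to_nat (i, fm_code f))"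
| "fm_code (Dist B f) = to_nat (5 :: nat, to_nat (B, fm_code f))"
| "fm_code (Common f) = to_nat (6 :: nat, to_nat f)"
| "fm_code Top = to_nat (7 :: nat, 0 :: nat)"

lemma fm_code_inject: "fm_code f = fm_code g \<Longrightarrow> f = g"
  by (induction f arbitrary: g) (case_tac g; simp)+

instance fm :: (finite, countable) countable
proof
  show "\<exists>to_nat :: ('a, 'b) fm \<Rightarrow> nat. inj to_nat"
    by (intro exI[of _ fm_code] injI fm_code_inject)
qed

lemma trancl_finite_path:
  assumes "(s, t) \<in> R\<^sup>+"
  shows "\<exists>F. finite F \<and> F \<subseteq> Field R \<and> (s, t) \<in> (R \<inter> F \<times> F)\<^sup>+"
  using assms
proof (induction rule: trancl_induct)
  case (base t)
  then show ?case
    by (intro exI[of _ "{s, t}"]) (auto simp: Field_def)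
next
  case (step t u)
  then obtain F where F: "finite F" "F \<subseteq> Field R" "(s, t) \<in> (R \<inter> F \<times> F)\<^sup>+"
    by blast
  let ?G = "F \<union> {t, u}"
  have "(s, t) \<in> (R \<inter> ?G \<times> ?G)\<^sup>+"
    by (rule trancl_mono[OF F(3)]) blast
  moreover have "(t, u) \<in> R \<inter> ?G \<times> ?G"
    using step by blast
  ultimately have "(s, u) \<in> (R \<inter> ?G \<times> ?G)\<^sup>+"
    by (rule trancl_into_trancl)
  moreover have "finite ?G" "?G \<subseteq> Field R"
    using F step by (auto simp: Field_def)
  ultimately show ?case
    by blast
qed

definition submodel :: "('s, 'a, 'p) model \<Rightarrow> ('s \<Rightarrow> 't) \<Rightarrow> 's set \<Rightarrow> ('t, 'a, 'p) model" where
  "submodel M e X =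
    \<lparr>worlds = e ` X, rel = (\<lambda>i. map_prod e e ` (rel M i \<inter> X \<times> X)),
     val = (\<lambda>t. val M (inv_into X e t))\<rparr>"

definition has_witnesses :: "('s, 'a, 'p) model \<Rightarrow> 's \<Rightarrow> 's set \<Rightarrow> bool" where
  "has_witnesses M s Y \<longleftrightarrow>
    (\<forall>i. (\<exists>t. (s, t) \<in> rel M i) \<longrightarrow> (\<exists>t\<in>Y. (s, t) \<in> rel M i)) \<and>
    (\<forall>i f. (\<exists>t. (s, t) \<in> rel M i \<and> \<not> sat M t f) \<longrightarrow> (\<exists>t\<in>Y. (s, t) \<in> rel M i \<and> \<not> sat M t f)) \<and>
    (\<forall>B f. (\<exists>t. (s, t) \<in> rel_D M B \<and> \<not> sat M t f) \<longrightarrow> (\<exists>t\<in>Y. (s, t) \<in> rel_D M B \<and> \<not> sat M t f)) \<and>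
    (\<forall>f. (\<exists>t. (s, t) \<in> (\<Union>i. rel M i)\<^sup>+ \<and> \<not> sat_prop (val M t) f) \<longrightarrow>
      (\<exists>t\<in>Y. (s, t) \<in> ((\<Union>i. rel M i) \<inter> Y \<times> Y)\<^sup>+ \<and> \<not> sat_prop (val M t) f))"

lemma has_witnesses_mono:
  assumes "has_witnesses M s Y" and "Y \<subseteq> X"
  shows "has_witnesses M s X"
proof -
  have "(\<Union>i. rel M i) \<inter> Y \<times> Y \<subseteq> (\<Union>i. rel M i) \<inter> X \<times> X"
    using assms(2) by blast
  then have "((\<Union>i. rel M i) \<inter> Y \<times> Y)\<^sup>+ \<subseteq> ((\<Union>i. rel M i) \<inter> X \<times> X)\<^sup>+"
    by (auto intro: trancl_mono)
  with assms show ?thesis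
    unfolding has_witnesses_def by (meson subsetD)
qed

definition closed_witnesses :: "('s, 'a, 'p) model \<Rightarrow> 's set \<Rightarrow> bool" where
  "closed_witnesses M X \<longleftrightarrow> (\<forall>s\<in>X. has_witnesses M s X)"

lemma trancl_map_prod:
  assumes "inj_on e X"
  shows "(map_prod e e ` (R \<inter> X \<times> X))\<^sup>+ = map_prod e e ` ((R \<inter> X \<times> X)\<^sup>+)"
proof -
  have "(e s, e t) \<in> (map_prod e e ` (R \<inter> X \<times> X))\<^sup>+" if "(s, t) \<in> (R \<inter> X \<times> X)\<^sup>+" for s t
    using that
  proof (induction rule: trancl_induct)
    case (base t)
    then show ?case
      by (intro r_into_trancl) force
  next
    case (step t u)
    from step.hyps(2) have "(e t, e u) \<in> map_prod e e ` (R \<inter> X \<times> X)"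
      by force
    with step.IH show ?case
      by (rule trancl_into_trancl)
  qed
  moreover have "\<exists>s t. a = e s \<and> b = e t \<and> (s, t) \<in> (R \<inter> X \<times> X)\<^sup>+"
    if "(a, b) \<in> (map_prod e e ` (R \<inter> X \<times> X))\<^sup>+" for a b
    using that
  proof (induction rule: trancl_induct)
    case (base b)
    then show ?case
      by (auto intro!: r_into_trancl)
  next
    case (step b c)
    from step.IH obtain s t where st: "a = e s" "b = e t" "(s, t) \<in> (R \<inter> X \<times> X)\<^sup>+"
      by blast
    from step.hyps(2) obtain t' u where u: "b = e t'" "c = e u" "(t', u) \<in> R \<inter> X \<times> X"
      by auto
    have "t \<in> X"
      using st(3) by (auto elim: tranclE)
    with u st assms have "t' = t"
      by (auto dest: inj_onD)
    with u st have "(s, u) \<in> (R \<inter> X \<times> X)\<^sup>+"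
      by (metis trancl_into_trancl)
    with u st show ?case
      by blast
  qed
  ultimately show ?thesis
    by (auto simp: image_iff map_prod_def split: prod.splits) blast+
qed

lemma sat_submodel:
  fixes M :: "('s, 'a, 'p) model" and e :: "'s \<Rightarrow> 't"
  assumes inj: "inj_on e X" and cl: "closed_witnesses M X"
  shows "s \<in> X \<Longrightarrow> sat (submodel M e X) (e s) f \<longleftrightarrow> sat M s f"
proof -
  have cw_Know: "\<exists>t\<in>X. (s, t) \<in> rel M i \<and> \<not> sat M t f"
    if "s \<in> X" "(s, t) \<in> rel M i" "\<not> sat M t f" for s t i f
    using cl that unfolding closed_witnesses_def has_witnesses_def by metis
  have cw_Dist: "\<exists>t\<in>X. (s, t) \<in> rel_D M B \<and> \<not> sat M t f"
    if "s \<in> X" "(s, t) \<in> rel_D M B" "\<not> sat M t f" for s t B f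
    using cl that unfolding closed_witnesses_def has_witnesses_def by metis
  have cw_Common: "\<exists>t\<in>X. (s, t) \<in> ((\<Union>i. rel M i) \<inter> X \<times> X)\<^sup>+ \<and> \<not> sat_prop (val M t) f"
    if "s \<in> X" "(s, t) \<in> (\<Union>i. rel M i)\<^sup>+" "\<not> sat_prop (val M t) f" for s t f
    using cl that unfolding closed_witnesses_def has_witnesses_def by metis
  show "s \<in> X \<Longrightarrow> sat (submodel M e X) (e s) f \<longleftrightarrow> sat M s f"
  proof (induction f arbitrary: s)
    case (Atom p)
    then show ?case
      using inj by (simp add: submodel_def)
  next
    case (Know i f)
    have "(e s, t) \<in> rel (submodel M e X) i \<longleftrightarrow> (\<exists>u\<in>X. t = e u \<and> (s, u) \<in> rel M i)" for t
      using inj Know.prems by (auto simp: submodel_def dest: inj_onD)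
    then have "sat (submodel M e X) (e s) (Know i f) \<longleftrightarrow> (\<forall>u\<in>X. (s, u) \<in> rel M i \<longrightarrow> sat M u f)"
      using Know.IH by auto
    also have "\<dots> \<longleftrightarrow> sat M s (Know i f)"
      using cw_Know[OF Know.prems] by auto
    finally show ?case .
  next
    case (Dist B f)
    have ne: "members B \<noteq> {}"
      using members[of B] by blast
    have "(e s, t) \<in> rel_D (submodel M e X) B \<longleftrightarrow> (\<exists>u\<in>X. t = e u \<and> (s, u) \<in> rel_D M B)" for t
    proof
      assume *: "(e s, t) \<in> rel_D (submodel M e X) B"
      then obtain u where u: "u \<in> X" "t = e u"
        using ne by (auto simp: submodel_def rel_D_def)
      with * show "\<exists>u\<in>X. t = e u \<and> (s, u) \<in> rel_D M B"
        using inj Dist.prems by (intro bexI[of _ u]) (auto simp: submodel_def rel_D_def dest: inj_onD)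
    next
      assume "\<exists>u\<in>X. t = e u \<and> (s, u) \<in> rel_D M B"
      then show "(e s, t) \<in> rel_D (submodel M e X) B"
        using Dist.prems by (force simp: submodel_def rel_D_def)
    qed
    then have "sat (submodel M e X) (e s) (Dist B f) \<longleftrightarrow> (\<forall>u\<in>X. (s, u) \<in> rel_D M B \<longrightarrow> sat M u f)"
      using Dist.IH by auto
    also have "\<dots> \<longleftrightarrow> sat M s (Dist B f)"
      using cw_Dist[OF Dist.prems] by auto
    finally show ?case .
  next
    case (Common f)
    let ?R = "\<Union>i. rel M i"
    have un: "(\<Union>i. rel (submodel M e X) i) = map_prod e e ` (?R \<inter> X \<times> X)"
      by (auto simp: submodel_def)
    have sub: "(?R \<inter> X \<times> X)\<^sup>+ \<subseteq> X \<times> X"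
      by (rule trancl_subset_Sigma) blast
    have "(e s, t) \<in> (\<Union>i. rel (submodel M e X) i)\<^sup>+ \<longleftrightarrow>
        (\<exists>u\<in>X. t = e u \<and> (s, u) \<in> (?R \<inter> X \<times> X)\<^sup>+)" for t
      unfolding un trancl_map_prod[OF inj]
      using inj Common.prems sub by (auto dest: inj_onD)
    moreover have "val (submodel M e X) (e u) = val M u" if "u \<in> X" for u
      using inj that by (simp add: submodel_def)
    ultimately have "sat (submodel M e X) (e s) (Common f) \<longleftrightarrow>
        (\<forall>u\<in>X. (s, u) \<in> (?R \<inter> X \<times> X)\<^sup>+ \<longrightarrow> sat_prop (val M u) f)"
      by auto
    also have "\<dots> \<longleftrightarrow> (\<forall>u. (s, u) \<in> ?R\<^sup>+ \<longrightarrow> sat_prop (val M u) f)"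
    proof -
      have "(?R \<inter> X \<times> X)\<^sup>+ \<subseteq> ?R\<^sup>+"
        by (auto intro: trancl_mono)
      then show ?thesis
        using cw_Common[OF Common.prems] by blast
    qed
    finally show ?case
      by simp
  qed auto
qed

lemma witnesses_exist:
  fixes M :: "('s, 'a :: finite, 'p :: countable) model"
  assumes M: "is_model M"
  shows "\<exists>Y. countable Y \<and> Y \<subseteq> worlds M \<and> has_witnesses M s Y"
proof -
  let ?R = "\<Union>i. rel M i"
  have Rsub: "rel M i \<subseteq> worlds M \<times> worlds M" for i
    using M by (simp add: is_model_def)
  have RDsub: "rel_D M B \<subseteq> worlds M \<times> worlds M" for B
  proof -
    obtain j where "j \<in> members B"
      using members[of B] by blast
    then show ?thesis
      using Rsub[of j] by (auto simp: rel_D_def)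
  qed
  have Fsub: "Field ?R \<subseteq> worlds M"
    using Rsub unfolding Field_def by blast
  define a where "a i = (SOME t. (s, t) \<in> rel M i)" for i
  define b where "b i f = (SOME t. (s, t) \<in> rel M i \<and> \<not> sat M t f)" for i f
  define c where "c B f = (SOME t. (s, t) \<in> rel_D M B \<and> \<not> sat M t f)" for B f
  define F where "F f = (SOME F. finite F \<and> F \<subseteq> worlds M \<and>
      (\<exists>t\<in>F. (s, t) \<in> (?R \<inter> F \<times> F)\<^sup>+ \<and> \<not> sat_prop (val M t) f))" for f
  have a: "(s, a i) \<in> rel M i" if "\<exists>t. (s, t) \<in> rel M i" for i
    unfolding a_def using that by (rule someI_ex)
  have b: "(s, b i f) \<in> rel M i \<and> \<not> sat M (b i f) f"
    if "\<exists>t. (s, t) \<in> rel M i \<and> \<not> sat M t f" for i f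
    unfolding b_def using that by (rule someI_ex)
  have c: "(s, c B f) \<in> rel_D M B \<and> \<not> sat M (c B f) f"
    if "\<exists>t. (s, t) \<in> rel_D M B \<and> \<not> sat M t f" for B f
    unfolding c_def using that by (rule someI_ex)
  have F: "finite (F f) \<and> F f \<subseteq> worlds M \<and>
      (\<exists>t\<in>F f. (s, t) \<in> (?R \<inter> F f \<times> F f)\<^sup>+ \<and> \<not> sat_prop (val M t) f)"
    if ex: "\<exists>t. (s, t) \<in> ?R\<^sup>+ \<and> \<not> sat_prop (val M t) f" for f
    unfolding F_def
  proof (rule someI_ex)
    from ex obtain t where t: "(s, t) \<in> ?R\<^sup>+" "\<not> sat_prop (val M t) f"
      by blast
    from trancl_finite_path[OF t(1)] obtain G
      where G: "finite G" "G \<subseteq> Field ?R" "(s, t) \<in> (?R \<inter> G \<times> G)\<^sup>+"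
      by blast
    have "(?R \<inter> G \<times> G)\<^sup>+ \<subseteq> G \<times> G"
      by (rule trancl_subset_Sigma) blast
    with G(3) have "t \<in> G"
      by blast
    with G t(2) Fsub show "\<exists>F. finite F \<and> F \<subseteq> worlds M \<and>
        (\<exists>t\<in>F. (s, t) \<in> (?R \<inter> F \<times> F)\<^sup>+ \<and> \<not> sat_prop (val M t) f)"
      by (intro exI[of _ G]) blast
  qed
  define Y where "Y = (range a \<union> range (case_prod b) \<union> range (case_prod c) \<union>
      (\<Union>f\<in>{f. finite (F f)}. F f)) \<inter> worlds M"
  have "countable (\<Union>f\<in>{f. finite (F f)}. F f)"
    by (rule countable_UN) (auto intro: countable_finite)
  then have "countable Y"
    unfolding Y_def by (intro countable_Int1 countable_Un) auto
  moreover have "Y \<subseteq> worlds M"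
    by (simp add: Y_def)
  moreover have "\<exists>t\<in>Y. (s, t) \<in> rel M i" if "\<exists>t. (s, t) \<in> rel M i" for i
  proof -
    have "a i \<in> Y"
      using a[OF that] Rsub[of i] unfolding Y_def by blast
    with a[OF that] show ?thesis
      by blast
  qed
  moreover have "\<exists>t\<in>Y. (s, t) \<in> rel M i \<and> \<not> sat M t f"
    if "\<exists>t. (s, t) \<in> rel M i \<and> \<not> sat M t f" for i f
  proof -
    have "b i f \<in> range (case_prod b)"
      by (metis case_prod_conv rangeI)
    then have "b i f \<in> Y"
      using b[OF that] Rsub[of i] unfolding Y_def by blast
    with b[OF that] show ?thesis
      by blast
  qed
  moreover have "\<exists>t\<in>Y. (s, t) \<in> rel_D M B \<and> \<not> sat M t f"
    if "\<exists>t. (s, t) \<in> rel_D M B \<and> \<not> sat M t f" for B f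
  proof -
    have "c B f \<in> range (case_prod c)"
      by (metis case_prod_conv rangeI)
    then have "c B f \<in> Y"
      using c[OF that] RDsub[of B] unfolding Y_def by blast
    with c[OF that] show ?thesis
      by blast
  qed
  moreover have "\<exists>t\<in>Y. (s, t) \<in> (?R \<inter> Y \<times> Y)\<^sup>+ \<and> \<not> sat_prop (val M t) f"
    if "\<exists>t. (s, t) \<in> ?R\<^sup>+ \<and> \<not> sat_prop (val M t) f" for f
  proof -
    from F[OF that] obtain t where t: "t \<in> F f" "(s, t) \<in> (?R \<inter> F f \<times> F f)\<^sup>+"
      "\<not> sat_prop (val M t) f"
      by blast
    have FY: "F f \<subseteq> Y"
      using F[OF that] unfolding Y_def by blast
    then have "?R \<inter> F f \<times> F f \<subseteq> ?R \<inter> Y \<times> Y"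
      by blast
    with t(2) have "(s, t) \<in> (?R \<inter> Y \<times> Y)\<^sup>+"
      by (rule trancl_mono)
    with t FY show ?thesis
      by blast
  qed
  ultimately show ?thesis
    unfolding has_witnesses_def by (intro exI[of _ Y] conjI allI impI)
qed

lemma closed_countable:
  fixes M :: "('s, 'a :: finite, 'p :: countable) model"
  assumes M: "is_model M" and s: "s \<in> worlds M"
  shows "\<exists>X. countable X \<and> X \<subseteq> worlds M \<and> s \<in> X \<and> closed_witnesses M X"
proof -
  obtain Y where Y: "countable (Y s) \<and> Y s \<subseteq> worlds M \<and> has_witnesses M s (Y s)" for s
    using witnesses_exist[OF M] by metis
  define G where "G n = ((\<lambda>X. \<Union>x\<in>X. Y x) ^^ n) {s}" for n
  define X where "X = (\<Union>n. G n)"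
  have G_Suc: "G (Suc n) = (\<Union>x\<in>G n. Y x)" for n
    by (simp add: G_def)
  have "countable (G n) \<and> G n \<subseteq> worlds M" for n
  proof (induction n)
    case 0
    then show ?case
      using s by (simp add: G_def)
  next
    case (Suc n)
    then have "countable (G (Suc n))"
      unfolding G_Suc using Y by (intro countable_UN) auto
    moreover have "G (Suc n) \<subseteq> worlds M"
      unfolding G_Suc using Y by blast
    ultimately show ?case
      by blast
  qed
  then have cX: "countable X" "X \<subseteq> worlds M"
    by (auto simp: X_def)
  have sX: "s \<in> X"
    unfolding X_def by (rule UN_I[of 0]) (simp_all add: G_def)
  have YX: "Y x \<subseteq> X" if "x \<in> X" for x
  proof -
    from that obtain n where "x \<in> G n"
      by (auto simp: X_def)
    then have "Y x \<subseteq> G (Suc n)"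
      by (auto simp: G_Suc)
    then show ?thesis
      unfolding X_def by blast
  qed
  have "closed_witnesses M X"
    unfolding closed_witnesses_def using Y YX by (meson has_witnesses_mono)
  with cX sX show ?thesis
    by blast
qed

lemma transfer_model:
  fixes M :: "('s, 'a :: finite, 'p :: countable) model"
  assumes inf: "infinite (UNIV :: 't set)" and M: "is_model M" and s: "s \<in> worlds M"
  shows "\<exists>(N :: ('t, 'a, 'p) model) t. t \<in> worlds N \<and> (\<forall>f. sat N t f \<longleftrightarrow> sat M s f) \<and>
    N \<in> KnDPC \<and> (M \<in> DnDPC \<longrightarrow> N \<in> DnDPC) \<and> (M \<in> TnDPC \<longrightarrow> N \<in> TnDPC)"
proof -
  obtain X where X: "countable X" "X \<subseteq> worlds M" "s \<in> X" "closed_witnesses M X"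
    using closed_countable[OF M s] by blast
  obtain g :: "nat \<Rightarrow> 't" where g: "inj g"
    using inf infinite_countable_subset by blast
  define e where "e = g \<circ> to_nat_on X"
  have e: "inj_on e X"
    unfolding e_def using g X(1) by (intro comp_inj_on inj_on_to_nat_on) (auto intro: inj_on_subset)
  let ?N = "submodel M e X"
  have N: "is_model ?N"
    using X by (auto simp: is_model_def submodel_def)
  moreover have "?N \<in> DnDPC" if "M \<in> DnDPC"
  proof -
    have "\<exists>t. (u, t) \<in> rel ?N i" if u: "u \<in> worlds ?N" for u i
    proof -
      from u obtain x where x: "x \<in> X" "u = e x"
        by (auto simp: submodel_def)
      have "\<exists>t. (x, t) \<in> rel M i"
        using \<open>M \<in> DnDPC\<close> x X(2) by (auto simp: DnDPC_def)
      then obtain t where "t \<in> X" "(x, t) \<in> rel M i"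
        using X(4) x(1) unfolding closed_witnesses_def has_witnesses_def by blast
      with x show ?thesis
        by (force simp: submodel_def)
    qed
    with N show ?thesis
      by (simp add: DnDPC_def)
  qed
  moreover have "?N \<in> TnDPC" if "M \<in> TnDPC"
  proof -
    have "(u, u) \<in> rel ?N i" if u: "u \<in> worlds ?N" for u i
    proof -
      from u obtain x where x: "x \<in> X" "u = e x"
        by (auto simp: submodel_def)
      have "(x, x) \<in> rel M i"
        using \<open>M \<in> TnDPC\<close> x X(2) by (auto simp: TnDPC_def refl_on_def)
      with x show ?thesis
        by (force simp: submodel_def)
    qed
    with N show ?thesis
      by (auto simp: TnDPC_def refl_on_def is_model_def)
  qed
  moreover have "e s \<in> worlds ?N"
    using X(3) by (simp add: submodel_def)
  ultimately show ?thesis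
    using sat_submodel[OF e X(4) X(3)]
    by (intro exI[of _ ?N] exI[of _ "e s"]) (simp add: KnDPC_def)
qed

lemma satisfiable_transfer:
  fixes f :: "('a :: finite, 'p :: countable) fm"
  assumes inf: "infinite (UNIV :: 't set)"
  shows "satisfiable (KnDPC :: ('s, 'a, 'p) model set) f \<Longrightarrow>
      satisfiable (KnDPC :: ('t, 'a, 'p) model set) f"
    and "satisfiable (DnDPC :: ('s, 'a, 'p) model set) f \<Longrightarrow>
      satisfiable (DnDPC :: ('t, 'a, 'p) model set) f"
    and "satisfiable (TnDPC :: ('s, 'a, 'p) model set) f \<Longrightarrow>
      satisfiable (TnDPC :: ('t, 'a, 'p) model set) f"
proof -
  have *: "\<exists>(N :: ('t, 'a, 'p) model) t. t \<in> worlds N \<and> sat N t f \<and>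
      N \<in> KnDPC \<and> (M \<in> DnDPC \<longrightarrow> N \<in> DnDPC) \<and> (M \<in> TnDPC \<longrightarrow> N \<in> TnDPC)"
    if "is_model M" "s \<in> worlds M" "sat M s f" for M :: "('s, 'a, 'p) model" and s
    using transfer_model[OF inf that(1,2)] that(3) by blast
  have m: "is_model M" if "M \<in> KnDPC \<or> M \<in> DnDPC \<or> M \<in> TnDPC" for M :: "('s, 'a, 'p) model"
    using that by (auto simp: KnDPC_def DnDPC_def TnDPC_def)
  show "satisfiable (KnDPC :: ('t, 'a, 'p) model set) f"
    if "satisfiable (KnDPC :: ('s, 'a, 'p) model set) f"
    using that m * unfolding satisfiable_def by metis
  show "satisfiable (DnDPC :: ('t, 'a, 'p) model set) f"
    if "satisfiable (DnDPC :: ('s, 'a, 'p) model set) f"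
    using that m * unfolding satisfiable_def by metis
  show "satisfiable (TnDPC :: ('t, 'a, 'p) model set) f"
    if "satisfiable (TnDPC :: ('s, 'a, 'p) model set) f"
    using that m * unfolding satisfiable_def by metis
qed

lemma satisfiable_world_type:
  fixes f :: "('a :: finite, 'p :: countable) fm"
  assumes s: "infinite (UNIV :: 's set)" and t: "infinite (UNIV :: 't set)"
  shows "satisfiable (KnDPC :: ('s, 'a, 'p) model set) f \<longleftrightarrow>
      satisfiable (KnDPC :: ('t, 'a, 'p) model set) f"
    and "satisfiable (DnDPC :: ('s, 'a, 'p) model set) f \<longleftrightarrow>
      satisfiable (DnDPC :: ('t, 'a, 'p) model set) f"
    and "satisfiable (TnDPC :: ('s, 'a, 'p) model set) f \<longleftrightarrow>
      satisfiable (TnDPC :: ('t, 'a, 'p) model set) f"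
  using satisfiable_transfer[OF s] satisfiable_transfer[OF t] by blast+

lemma entails_iff_not_satisfiable: "entails L f g \<longleftrightarrow> \<not> satisfiable L (And f (Neg g))"
  by (auto simp: entails_def satisfiable_def)

lemma entails_world_type:
  fixes f g :: "('a :: finite, 'p :: countable) fm"
  assumes "infinite (UNIV :: 's set)" "infinite (UNIV :: 't set)"
  shows "entails (KnDPC :: ('s, 'a, 'p) model set) f g \<longleftrightarrow>
      entails (KnDPC :: ('t, 'a, 'p) model set) f g"
    and "entails (DnDPC :: ('s, 'a, 'p) model set) f g \<longleftrightarrow>
      entails (DnDPC :: ('t, 'a, 'p) model set) f g"
    and "entails (TnDPC :: ('s, 'a, 'p) model set) f g \<longleftrightarrow>
      entails (TnDPC :: ('t, 'a, 'p) model set) f g"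
  unfolding entails_iff_not_satisfiable
  using satisfiable_world_type[OF assms] by blast+

end

theory Submission
  imports Defs
begin

text \<open>Let \<open>Q = P - {p}\<close> and let \<open>k\<close> be the modal depth of \<open>f\<close>. The interpolant says that the current
  world has the same depth-\<open>k\<close> description over \<open>Q\<close> as some world of some model of \<open>f\<close>, where the
  description also records which \<open>Q\<close>-valuations are reachable. If \<open>u\<close> in \<open>M\<close> and \<open>v\<close> in \<open>N\<close> have the
  same depth-\<open>k\<close> description and \<open>v\<close> satisfies \<open>f\<close>, the two models are amalgamated: for \<open>k\<close> steps one
  moves in the product of \<open>M\<close> and \<open>N\<close> along pairs with equal descriptions of decreasing depth; after
  that one moves in \<open>M\<close> alone, and \<open>p\<close> may be copied from any world with the right \<open>Q\<close>-valuation
  that is reachable from the point \<open>v'\<close> where \<open>N\<close> was left. Off \<open>p\<close> the amalgam projects onto \<open>M\<close>,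
  and up to depth \<open>k\<close> (with \<open>p\<close>) it looks like \<open>N\<close>, because exactly the valuations reachable from
  \<open>v'\<close> remain reachable.\<close>

subsection \<open>Descriptions\<close>

text \<open>The enumeration of \<open>S\<close> is arbitrary. Ending in \<open>Top\<close> gives the
  empty conjunction no atoms, so the construction also works when \<open>P - {p}\<close> is
  empty.\<close>

definition Conj :: "('a, 'p) fm set \<Rightarrow> ('a, 'p) fm" where
  "Conj S = foldr And (SOME xs. set xs = S) Top"

definition Disj :: "('a, 'p) fm set \<Rightarrow> ('a, 'p) fm" where
  "Disj S = Neg (Conj (Neg ` S))"

definition PConj :: "'p pfm set \<Rightarrow> 'p pfm" where
  "PConj S = foldr PAnd (SOME xs. set xs = S) PTop"

lemma set_some_list: "finite S \<Longrightarrow> set (SOME xs. set xs = S) = S"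
  by (rule someI_ex) (rule finite_list)

lemma sat_Conj:
  assumes "finite S"
  shows "sat M s (Conj S) \<longleftrightarrow> (\<forall>f\<in>S. sat M s f)"
proof -
  have "sat M s (foldr And xs Top) \<longleftrightarrow> (\<forall>f\<in>set xs. sat M s f)" for xs
    by (induction xs) auto
  then show ?thesis
    by (simp add: Conj_def set_some_list assms)
qed

lemma atoms_Conj:
  assumes "finite S"
  shows "atoms (Conj S) = (\<Union>f\<in>S. atoms f)"
proof -
  have "atoms (foldr And xs Top) = (\<Union>f\<in>set xs. atoms f)" for xs :: "('a, 'b) fm list"
    by (induction xs) auto
  then show ?thesis
    by (simp add: Conj_def set_some_list assms)
qed

lemma sat_Disj: "finite S \<Longrightarrow> sat M s (Disj S) \<longleftrightarrow> (\<exists>f\<in>S. sat M s f)"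
  by (simp add: Disj_def sat_Conj)

lemma atoms_Disj: "finite S \<Longrightarrow> atoms (Disj S) = (\<Union>f\<in>S. atoms f)"
  by (simp add: Disj_def atoms_Conj)

lemma sat_prop_PConj:
  assumes "finite S"
  shows "sat_prop X (PConj S) \<longleftrightarrow> (\<forall>f\<in>S. sat_prop X f)"
proof -
  have "sat_prop X (foldr PAnd xs PTop) \<longleftrightarrow> (\<forall>f\<in>set xs. sat_prop X f)" for xs
    by (induction xs) auto
  then show ?thesis
    by (simp add: PConj_def set_some_list assms)
qed

lemma atoms_prop_PConj:
  assumes "finite S"
  shows "atoms_prop (PConj S) = (\<Union>f\<in>S. atoms_prop f)"
proof -
  have "atoms_prop (foldr PAnd xs PTop) = (\<Union>f\<in>set xs. atoms_prop f)" for xs :: "'a pfm list"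
    by (induction xs) auto
  then show ?thesis
    by (simp add: PConj_def set_some_list assms)
qed

definition desc :: "('a, 'p) fm set \<Rightarrow> ('a, 'p) fm set \<Rightarrow> ('a, 'p) fm" where
  "desc S A = Conj (A \<union> Neg ` (S - A))"

definition desc_prop :: "'p set \<Rightarrow> 'p set \<Rightarrow> 'p pfm" where
  "desc_prop Q X = PConj (PAtom ` X \<union> (\<lambda>q. PNeg (PAtom q)) ` (Q - X))"

lemma sat_desc:
  assumes "finite S" "A \<subseteq> S"
  shows "sat M s (desc S A) \<longleftrightarrow> {f \<in> S. sat M s f} = A"
proof -
  have "finite (A \<union> Neg ` (S - A))"
    using assms by (auto intro: finite_subset)
  then show ?thesis
    using assms(2) by (auto simp: desc_def sat_Conj ball_Un)
qed

lemma atoms_desc: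
  assumes "finite S" "A \<subseteq> S"
  shows "atoms (desc S A) \<subseteq> (\<Union>f\<in>S. atoms f)"
proof -
  have "finite (A \<union> Neg ` (S - A))"
    using assms by (auto intro: finite_subset)
  then show ?thesis
    using assms(2) by (auto simp: desc_def atoms_Conj)
qed

lemma sat_desc_prop:
  assumes "finite Q" "X \<subseteq> Q"
  shows "sat_prop Y (desc_prop Q X) \<longleftrightarrow> Y \<inter> Q = X"
proof -
  have "finite (PAtom ` X \<union> (\<lambda>q. PNeg (PAtom q)) ` (Q - X))"
    using assms by (auto intro: finite_subset)
  then show ?thesis
    using assms(2) by (auto simp: desc_prop_def sat_prop_PConj ball_Un)
qed

lemma atoms_desc_prop:
  assumes "finite Q" "X \<subseteq> Q"
  shows "atoms_prop (desc_prop Q X) \<subseteq> Q"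
proof -
  have "finite (PAtom ` X \<union> (\<lambda>q. PNeg (PAtom q)) ` (Q - X))"
    using assms by (auto intro: finite_subset)
  then show ?thesis
    using assms(2) by (auto simp: desc_prop_def atoms_prop_PConj)
qed

text \<open>The probe built from \<open>X\<close> denies that a world with
  \<open>Q\<close>-valuation \<open>X\<close> is reachable. Together these probes determine
  \<open>reach_vals\<close>.\<close>

definition base_probes :: "'p set \<Rightarrow> ('a, 'p) fm set" where
  "base_probes Q = Atom ` Q \<union> (\<lambda>X. Common (PNeg (desc_prop Q X))) ` Pow Q"

text \<open>The new probes of a level say which types of the previous level are absent among the
  \<open>B\<close>-successors. As there are finitely many coalitions, each level stays finite. The
  base probes recur at every level, so agreement at any level fixes valuation and reachable
  valuations.\<close>

primrec probes :: "'p set \<Rightarrow> nat \<Rightarrow> ('a, 'p) fm set" where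
  "probes Q 0 = base_probes Q"
| "probes Q (Suc n) = base_probes Q \<union>
    (\<lambda>(B, A). Dist B (Neg (desc (probes Q n) A))) ` (UNIV \<times> Pow (probes Q n))"

lemma finite_probes: "finite Q \<Longrightarrow> finite (probes Q n :: ('a :: finite, 'p) fm set)"
  by (induction n) (simp_all add: base_probes_def)

lemma atoms_probes:
  fixes f :: "('a :: finite, 'p) fm"
  assumes "finite Q"
  shows "f \<in> probes Q n \<Longrightarrow> atoms f \<subseteq> Q"
proof (induction n arbitrary: f)
  case 0
  then show ?case
    by (auto simp: base_probes_def dest: subsetD[OF atoms_desc_prop[OF assms], rotated])
next
  case (Suc n)
  have desc: "atoms (desc (probes Q n) A) \<subseteq> Q" if "A \<subseteq> probes Q n" for A :: "('a, 'p) fm set"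
    using atoms_desc[OF finite_probes[OF assms] that] Suc.IH by blast
  show ?case
    using Suc.prems
    by (auto simp: base_probes_def
        dest: subsetD[OF desc, rotated] subsetD[OF atoms_desc_prop[OF assms], rotated])
qed

definition agree :: "'p set \<Rightarrow> nat \<Rightarrow> ('s, 'a, 'p) model \<Rightarrow> 's \<Rightarrow> ('t, 'a, 'p) model \<Rightarrow> 't \<Rightarrow> bool" where
  "agree Q n M u N v \<longleftrightarrow> (\<forall>f\<in>probes Q n. sat M u f \<longleftrightarrow> sat N v f)"

abbreviation reach :: "('s, 'a, 'p) model \<Rightarrow> ('s \<times> 's) set" where
  "reach M \<equiv> (\<Union>i. rel M i)\<^sup>+"

definition reach_vals :: "('s, 'a, 'p) model \<Rightarrow> 'p set \<Rightarrow> 's \<Rightarrow> 'p set set" where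
  "reach_vals M Q s = (\<lambda>t. val M t \<inter> Q) ` (reach M `` {s})"

lemma reach_valsI: "(s, t) \<in> reach M \<Longrightarrow> X = val M t \<inter> Q \<Longrightarrow> X \<in> reach_vals M Q s"
  by (auto simp: reach_vals_def)

lemma reach_vals_mono: "(s, t) \<in> reach M \<Longrightarrow> reach_vals M Q t \<subseteq> reach_vals M Q s"
  unfolding reach_vals_def by (auto intro: trancl_trans)

lemma agree_sym: "agree Q n M u N v \<Longrightarrow> agree Q n N v M u"
  by (simp add: agree_def)

lemma agree_base:
  assumes "agree Q n M u N v" "f \<in> base_probes Q"
  shows "sat M u f \<longleftrightarrow> sat N v f"
  using assms by (cases n) (auto simp: agree_def)

lemma agree_val:
  assumes "agree Q n M u N v"
  shows "val M u \<inter> Q = val N v \<inter> Q"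
proof -
  have "q \<in> val M u \<longleftrightarrow> q \<in> val N v" if "q \<in> Q" for q
    using agree_base[OF assms, of "Atom q"] that by (simp add: base_probes_def)
  then show ?thesis
    by blast
qed

lemma sat_Common_not_desc_prop:
  assumes "finite Q" "X \<subseteq> Q"
  shows "sat M s (Common (PNeg (desc_prop Q X))) \<longleftrightarrow> X \<notin> reach_vals M Q s"
  using sat_desc_prop[OF assms] by (auto simp: reach_vals_def)

lemma agree_reach_vals:
  assumes "finite Q" "agree Q n M u N v"
  shows "reach_vals M Q u = reach_vals N Q v"
proof -
  have "X \<in> reach_vals M Q u \<longleftrightarrow> X \<in> reach_vals N Q v" if "X \<subseteq> Q" for X
    using agree_base[OF assms(2), of "Common (PNeg (desc_prop Q X))"] that
    by (simp add: base_probes_def sat_Common_not_desc_prop[OF assms(1) that] del: sat.simps)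
  moreover have "reach_vals M Q u \<subseteq> Pow Q" "reach_vals N Q v \<subseteq> Pow Q"
    by (auto simp: reach_vals_def)
  ultimately show ?thesis
    by blast
qed

text \<open>This is the forth condition of a bounded bisimulation. With \<open>A\<close> the type of
  \<open>u'\<close>, the probe denying a \<open>B\<close>-successor of type \<open>A\<close> fails
  at \<open>u\<close>, hence at \<open>v\<close>. The back condition follows by
  \<open>agree_sym\<close>.\<close>

lemma agree_step:
  fixes M :: "('s, 'a :: finite, 'p) model"
  assumes "finite Q" "agree Q (Suc n) M u N v" "(u, u') \<in> rel_D M B"
  shows "\<exists>v'. (v, v') \<in> rel_D N B \<and> agree Q n M u' N v'"
proof -
  define A where "A = {f \<in> probes Q n. sat M u' f}"
  have A: "A \<subseteq> probes Q n"
    by (auto simp: A_def)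
  note sd = sat_desc[OF finite_probes[OF assms(1)] A]
  let ?f = "Dist B (Neg (desc (probes Q n) A))"
  have "?f \<in> probes Q (Suc n)"
    using A by auto
  then have "sat M u ?f \<longleftrightarrow> sat N v ?f"
    using assms(2) by (simp only: agree_def)
  moreover have "\<not> sat M u ?f"
    using assms(3) sd[of M u'] A_def by auto
  ultimately obtain v' where "(v, v') \<in> rel_D N B" "{f \<in> probes Q n. sat N v' f} = A"
    by (auto simp: sd)
  then show ?thesis
    unfolding A_def agree_def by blast
qed

subsection \<open>Preservation of satisfaction\<close>

lemma rel_D_single: "rel_D M (Coalition {i}) = rel M i"
  by (simp add: rel_D_def Coalition_inverse)

lemma sat_Know_Dist: "sat M s (Know i f) \<longleftrightarrow> sat M s (Dist (Coalition {i}) f)"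
  by (simp add: rel_D_single)

lemma rel_D_worlds:
  assumes "is_model M" "(s, t) \<in> rel_D M B"
  shows "s \<in> worlds M \<and> t \<in> worlds M"
proof -
  obtain i where "i \<in> members B"
    using members[of B] by blast
  then show ?thesis
    using assms by (auto simp: rel_D_def is_model_def)
qed

lemma reach_worlds:
  assumes "is_model M" "(s, t) \<in> reach M"
  shows "s \<in> worlds M \<and> t \<in> worlds M"
proof -
  have "reach M \<subseteq> worlds M \<times> worlds M"
    using assms(1) by (intro trancl_subset_Sigma) (auto simp: is_model_def)
  with assms(2) show ?thesis
    by blast
qed

lemma sat_prop_cong:
  "(\<And>q. q \<in> atoms_prop f \<Longrightarrow> q \<in> X \<longleftrightarrow> q \<in> Y) \<Longrightarrow> sat_prop X f \<longleftrightarrow> sat_prop Y f"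
  by (induction f) auto

text \<open>The back condition is imposed on \<open>rel_D\<close> because back conditions for single
  agents may have different witnesses and would not yield a common \<open>B\<close>-successor.
  Singleton coalitions recover \<open>Know\<close> and, along paths, \<open>Common\<close>.\<close>

lemma sat_bounded_morphism:
  assumes M: "is_model M"
    and zig: "\<And>B x y. (x, y) \<in> rel_D M B \<Longrightarrow> (g x, g y) \<in> rel_D N B"
    and zag: "\<And>B x u. x \<in> worlds M \<Longrightarrow> (g x, u) \<in> rel_D N B \<Longrightarrow> \<exists>y. (x, y) \<in> rel_D M B \<and> g y = u"
    and val: "\<And>x. x \<in> worlds M \<Longrightarrow> val M x \<inter> Q = val N (g x) \<inter> Q"
  shows "x \<in> worlds M \<Longrightarrow> atoms f \<subseteq> Q \<Longrightarrow> sat M x f \<longleftrightarrow> sat N (g x) f"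
proof -
  have D: "sat M x (Dist B f) \<longleftrightarrow> sat N (g x) (Dist B f)"
    if "x \<in> worlds M" "\<And>y. y \<in> worlds M \<Longrightarrow> sat M y f \<longleftrightarrow> sat N (g y) f" for x B f
    using that zig zag rel_D_worlds[OF M] by simp metis
  have reach_forth: "(g x, g y) \<in> reach N" if "(x, y) \<in> reach M" for x y
    using that
  proof (induction rule: trancl_induct)
    case (base y)
    then show ?case
      using zig[of x y "Coalition {i}" for i] by (auto simp: rel_D_single)
  next
    case (step y z)
    then have "(g y, g z) \<in> (\<Union>i. rel N i)"
      using zig[of y z "Coalition {i}" for i] by (auto simp: rel_D_single)
    with step.IH show ?case
      by (rule trancl_into_trancl)
  qed
  have reach_back: "\<exists>y. (x, y) \<in> reach M \<and> g y = u" if gx: "(g x, u) \<in> reach N" and x: "x \<in> worlds M" for x u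
    using gx
  proof (induction rule: trancl_induct)
    case (base u)
    then obtain i where "(g x, u) \<in> rel N i"
      by blast
    then obtain y where "(x, y) \<in> rel M i" "g y = u"
      using zag[of x u "Coalition {i}"] x by (auto simp: rel_D_single)
    then show ?case
      by blast
  next
    case (step u w)
    then obtain i y where y: "(x, y) \<in> reach M" "g y = u" "(u, w) \<in> rel N i"
      by blast
    then obtain z where "(y, z) \<in> rel M i" "g z = w"
      using zag[of y w "Coalition {i}"] reach_worlds[OF M y(1)] by (auto simp: rel_D_single)
    with y(1) show ?case
      by (blast intro: trancl_into_trancl)
  qed
  have val': "sat_prop (val M y) f \<longleftrightarrow> sat_prop (val N (g y)) f"
    if "y \<in> worlds M" "atoms_prop f \<subseteq> Q" for y f
    using val[OF that(1)] that(2) by (intro sat_prop_cong) blast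
  show "x \<in> worlds M \<Longrightarrow> atoms f \<subseteq> Q \<Longrightarrow> sat M x f \<longleftrightarrow> sat N (g x) f"
  proof (induction f arbitrary: x)
    case (Atom q)
    then show ?case
      using val[of x] by auto
  next
    case (Know i f)
    then show ?case
      unfolding sat_Know_Dist by (intro D) auto
  next
    case (Dist B f)
    then show ?case
      by (intro D) auto
  next
    case (Common f)
    then show ?case
      using reach_forth reach_back val' reach_worlds[OF M] by simp metis
  qed auto
qed

lemma sat_Common_reach_vals:
  assumes "atoms_prop f \<subseteq> P"
  shows "sat K s (Common f) \<longleftrightarrow> (\<forall>X\<in>reach_vals K P s. sat_prop X f)"
proof -
  have "sat_prop (X \<inter> P) f \<longleftrightarrow> sat_prop X f" for X
    using assms by (intro sat_prop_cong) blast
  then show ?thesis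
    by (auto simp: reach_vals_def)
qed

text \<open>\<open>Common\<close> costs no depth: its truth is fixed by \<open>reach_vals\<close>,
  which the amalgam shares with \<open>N\<close> at every matched pair.\<close>

primrec depth :: "('a, 'p) fm \<Rightarrow> nat" where
  "depth Top = 0"
| "depth (Atom p) = 0"
| "depth (Neg f) = depth f"
| "depth (And f g) = max (depth f) (depth g)"
| "depth (Or f g) = max (depth f) (depth g)"
| "depth (Know i f) = Suc (depth f)"
| "depth (Dist B f) = Suc (depth f)"
| "depth (Common f) = 0"

subsection \<open>The amalgam\<close>

text \<open>\<open>Matched u v n\<close> is a pair with equal descriptions of depth \<open>n\<close>. In \<open>Free u w v\<close>, \<open>N\<close> has been
  left at \<open>v\<close> and \<open>p\<close> is copied from \<open>w\<close>.\<close>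

datatype ('s, 't) amalgam_world = Matched 's 't nat | Free 's 't 't

primrec left :: "('s, 't) amalgam_world \<Rightarrow> 's" where
  "left (Matched u v n) = u"
| "left (Free u w v) = u"

primrec right :: "('s, 't) amalgam_world \<Rightarrow> 't" where
  "right (Matched u v n) = v"
| "right (Free u w v) = w"

locale amalgam =
  fixes M :: "('s, 'a :: finite, 'p) model" and N :: "('t, 'a, 'p) model"
    and Q :: "'p set" and p :: 'p
  assumes M: "is_model M" and N: "is_model N" and finQ: "finite Q" and pQ: "p \<notin> Q"
begin

text \<open>For free worlds the inclusion is the invariant that supplies a partner \<open>w\<close>
  for every later move in \<open>M\<close>. Equality would not survive, since
  \<open>reach_vals\<close> may shrink along an edge of \<open>M\<close> while \<open>v\<close>
  stays fixed.\<close>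

fun is_world :: "('s, 't) amalgam_world \<Rightarrow> bool" where
  "is_world (Matched u v n) \<longleftrightarrow> u \<in> worlds M \<and> v \<in> worlds N \<and> agree Q n M u N v"
| "is_world (Free u w v) \<longleftrightarrow> u \<in> worlds M \<and> (v, w) \<in> reach N \<and> val M u \<inter> Q = val N w \<inter> Q \<and>
    reach_vals M Q u \<subseteq> reach_vals N Q v"

text \<open>The depth may drop by at most one along an edge, but it need not drop: this keeps the loops of
  reflexive models.\<close>

fun right_step :: "'a \<Rightarrow> ('s, 't) amalgam_world \<Rightarrow> ('s, 't) amalgam_world \<Rightarrow> bool" where
  "right_step i (Matched u v n) (Matched u' v' n') \<longleftrightarrow> (v, v') \<in> rel N i \<and> n \<le> Suc n'"
| "right_step i (Matched u v n) (Free u' w' v') \<longleftrightarrow> n = 0 \<and> v' = v"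
| "right_step i (Free u w v) (Free u' w' v') \<longleftrightarrow> v' = v"
| "right_step i (Free u w v) (Matched u' v' n') \<longleftrightarrow> False"

text \<open>All atoms but \<open>p\<close>, also those outside \<open>Q\<close>, come from
  \<open>M\<close>, because the formulas compared with \<open>M\<close> may use any of them.\<close>

definition amalg :: "(('s, 't) amalgam_world, 'a, 'p) model" where
  "amalg = \<lparr>worlds = Collect is_world,
    rel = (\<lambda>i. {(x, y). is_world x \<and> is_world y \<and> (left x, left y) \<in> rel M i \<and> right_step i x y}),
    val = (\<lambda>x. (val M (left x) - {p}) \<union> (val N (right x) \<inter> {p}))\<rparr>"

lemma worlds_amalg [simp]: "worlds amalg = Collect is_world"
  by (simp add: amalg_def)

lemma rel_amalg: "(x, y) \<in> rel amalg i \<longleftrightarrow>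
    is_world x \<and> is_world y \<and> (left x, left y) \<in> rel M i \<and> right_step i x y"
  by (simp add: amalg_def)

lemma rel_D_amalg: "(x, y) \<in> rel_D amalg B \<longleftrightarrow>
    is_world x \<and> is_world y \<and> (left x, left y) \<in> rel_D M B \<and> (\<forall>i\<in>members B. right_step i x y)"
  using members[of B] by (auto simp: rel_D_def rel_amalg)

lemma val_left: "val amalg x \<inter> - {p} = val M (left x) \<inter> - {p}"
  by (auto simp: amalg_def)

lemma is_world_val: "is_world x \<Longrightarrow> val M (left x) \<inter> Q = val N (right x) \<inter> Q"
  by (cases x) (auto dest: agree_val)

lemma val_right:
  assumes "is_world x"
  shows "val amalg x \<inter> insert p Q = val N (right x) \<inter> insert p Q"
  using is_world_val[OF assms] pQ by (auto simp: amalg_def)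

lemma is_model_amalg: "is_world x \<Longrightarrow> is_model amalg"
  by (auto simp: is_model_def rel_amalg)

lemma matched_step_left:
  assumes "is_world (Matched u v (Suc n))" "(u, u') \<in> rel_D M B"
  shows "\<exists>v'. (v, v') \<in> rel_D N B \<and> (Matched u v (Suc n), Matched u' v' n) \<in> rel_D amalg B"
proof -
  obtain v' where v': "(v, v') \<in> rel_D N B" "agree Q n M u' N v'"
    using agree_step[OF finQ _ assms(2), of n N v] assms(1) by auto
  then show ?thesis
    using assms rel_D_worlds[OF N v'(1)] rel_D_worlds[OF M assms(2)]
    by (auto simp: rel_D_amalg) (auto simp: rel_D_def)
qed

lemma matched_step_right:
  assumes "is_world (Matched u v (Suc n))" "(v, v') \<in> rel_D N B"
  shows "\<exists>u'. (u, u') \<in> rel_D M B \<and> (Matched u v (Suc n), Matched u' v' n) \<in> rel_D amalg B"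
proof -
  have "agree Q (Suc n) N v M u"
    using assms(1) by (simp add: agree_sym)
  from agree_step[OF finQ this assms(2)] obtain u'
    where u': "(u, u') \<in> rel_D M B" "agree Q n M u' N v'"
    by (auto dest: agree_sym)
  then show ?thesis
    using assms rel_D_worlds[OF N assms(2)] rel_D_worlds[OF M u'(1)]
    by (auto simp: rel_D_amalg) (auto simp: rel_D_def)
qed

section \<open>Leaving the product and moving in \<open>M\<close> alone\<close>

definition exits :: "('s, 't) amalgam_world \<Rightarrow> 't \<Rightarrow> bool" where
  "exits x v \<longleftrightarrow> is_world x \<and> (x = Matched (left x) v 0 \<or> x = Free (left x) (right x) v)"

lemma exits_reach_vals: "exits x v \<Longrightarrow> reach_vals M Q (left x) \<subseteq> reach_vals N Q v"
  unfolding exits_def using agree_reach_vals[OF finQ, of _ M _ N v] by (cases x) auto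

lemma exits_step:
  assumes "exits x v" "(left x, u') \<in> rel M i" "(v, w') \<in> reach N" "val M u' \<inter> Q = val N w' \<inter> Q"
  shows "(x, Free u' w' v) \<in> rel amalg i \<and> exits (Free u' w' v) v"
proof -
  have "(left x, u') \<in> reach M"
    using assms(2) by blast
  then have "is_world (Free u' w' v)"
    using assms reach_vals_mono[of "left x" u' M Q] exits_reach_vals[OF assms(1)]
      reach_worlds[OF M] by auto
  moreover have "right_step i x (Free u' w' v)"
    using assms(1) unfolding exits_def by (cases x) auto
  ultimately show ?thesis
    using assms(1,2) by (auto simp: rel_amalg exits_def)
qed

lemma exits_match:
  assumes "exits x v" "(left x, u') \<in> reach M"
  shows "\<exists>w'. (v, w') \<in> reach N \<and> val M u' \<inter> Q = val N w' \<inter> Q"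
proof -
  have "val M u' \<inter> Q \<in> reach_vals N Q v"
    using exits_reach_vals[OF assms(1)] assms(2) by (auto simp: reach_vals_def)
  then show ?thesis
    by (auto simp: reach_vals_def)
qed

text \<open>Any path of \<open>M\<close> lifts to free worlds. \<open>exits_match\<close> supplies
  the intermediate partners, so the last partner \<open>w'\<close> can be chosen freely among those
  with the right valuation.\<close>

lemma exits_reach:
  assumes "exits x v" "(left x, u') \<in> reach M" "(v, w') \<in> reach N" "val M u' \<inter> Q = val N w' \<inter> Q"
  shows "(x, Free u' w' v) \<in> reach amalg \<and> exits (Free u' w' v) v"
  using assms(2-)
proof (induction arbitrary: w' rule: trancl_induct)
  case (base u')
  then show ?case
    using exits_step[OF assms(1)] by blast
next
  case (step t u')
  obtain w where w: "(v, w) \<in> reach N" "val M t \<inter> Q = val N w \<inter> Q"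
    using exits_match[OF assms(1) step.hyps(1)] by blast
  have IH: "(x, Free t w v) \<in> reach amalg" "exits (Free t w v) v"
    using step.IH[OF w] by auto
  obtain i where "(t, u') \<in> rel M i"
    using step.hyps(2) by blast
  then have "(Free t w v, Free u' w' v) \<in> rel amalg i \<and> exits (Free u' w' v) v"
    using exits_step[OF IH(2)] step.prems by simp
  with IH(1) show ?case
    by (blast intro: trancl_into_trancl)
qed

text \<open>A single target serves all of \<open>B\<close>: a step to a free world restricts the
  right component independently of the agent, and in the matched case \<open>agree_step\<close>
  treats the coalition as a whole.\<close>

lemma left_back:
  assumes "is_world x" "(left x, u') \<in> rel_D M B"
  shows "\<exists>y. (x, y) \<in> rel_D amalg B \<and> left y = u'"
proof (cases "\<exists>v. exits x v")
  case True
  then obtain v where v: "exits x v"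
    by blast
  obtain i where "i \<in> members B"
    using members[of B] by blast
  then have "(left x, u') \<in> reach M"
    using assms(2) by (auto simp: rel_D_def)
  from exits_match[OF v this] obtain w' where "(v, w') \<in> reach N" "val M u' \<inter> Q = val N w' \<inter> Q"
    by blast
  then have "(x, Free u' w' v) \<in> rel_D amalg B"
    using exits_step[OF v] assms(2) by (auto simp: rel_D_def)
  then show ?thesis
    by (intro exI[of _ "Free u' w' v"]) simp
next
  case False
  then obtain u v n where x: "x = Matched u v (Suc n)"
    using assms(1) unfolding exits_def
    by (metis amalgam_world.exhaust left.simps not0_implies_Suc right.simps(2))
  then obtain v' where "(x, Matched u' v' n) \<in> rel_D amalg B"
    using matched_step_left[of u v n u' B] assms by auto
  then show ?thesis
    by (intro exI[of _ "Matched u' v' n"]) simp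
qed

lemma sat_amalg_left:
  assumes "is_world x" "p \<notin> atoms f"
  shows "sat amalg x f \<longleftrightarrow> sat M (left x) f"
  using assms
  by (intro sat_bounded_morphism[where Q = "- {p}"])
    (auto simp: is_model_amalg val_left left_back dest: rel_D_amalg[THEN iffD1])

section \<open>Comparison of the amalgam with \<open>N\<close>\<close>

lemma reach_amalg_right:
  assumes "(Matched u v n, y) \<in> reach amalg"
  shows "(v, right y) \<in> reach N"
proof -
  \<comment> \<open>Among free worlds the right components need not form a path of \<open>N\<close>,
    so the induction also tracks the exit point \<open>v'\<close>, from which each copied world is
    reachable.\<close>
  have "(v, right y) \<in> reach N \<and> (\<forall>u w v'. y = Free u w v' \<longrightarrow> v' = v \<or> (v, v') \<in> reach N)"
    using assms
  proof (induction rule: trancl_induct)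
    case (base y)
    then show ?case
      by (cases y) (auto simp: rel_amalg)
  next
    case (step y z)
    then obtain i where i: "(y, z) \<in> rel amalg i"
      by blast
    show ?case
      using i step.IH
      by (cases y; cases z) (auto simp: rel_amalg intro: trancl_trans trancl_into_trancl)
  qed
  then show ?thesis
    by blast
qed

text \<open>The first \<open>n\<close> steps towards a world \<open>w\<close> of \<open>N\<close>
  are matched. If \<open>w\<close> lies further, depth-0 agreement gives some \<open>u'\<close>
  reachable in \<open>M\<close> with the same \<open>Q\<close>-valuation, and a free world copies
  \<open>p\<close> from \<open>w\<close> itself.\<close>

lemma reach_vals_matched_subset:
  assumes "is_world (Matched u v n)"
  shows "reach_vals N (insert p Q) v \<subseteq> reach_vals amalg (insert p Q) (Matched u v n)"
  using assms
proof (induction n arbitrary: u v)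
  case 0
  have ex: "exits (Matched u v 0) v"
    using 0 by (simp add: exits_def)
  show ?case
  proof
    fix X assume "X \<in> reach_vals N (insert p Q) v"
    then obtain w where w: "(v, w) \<in> reach N" "X = val N w \<inter> insert p Q"
      by (auto simp: reach_vals_def)
    then have "val N w \<inter> Q \<in> reach_vals M Q u"
      using agree_reach_vals[OF finQ, of 0 M u N v] 0 by (auto simp: reach_vals_def)
    then obtain u' where "(u, u') \<in> reach M" "val M u' \<inter> Q = val N w \<inter> Q"
      by (auto simp: reach_vals_def)
    with exits_reach[OF ex _ w(1)] have "(Matched u v 0, Free u' w v) \<in> reach amalg"
      "is_world (Free u' w v)"
      by (auto simp: exits_def)
    then show "X \<in> reach_vals amalg (insert p Q) (Matched u v 0)"
      using val_right[of "Free u' w v"] w(2) by (metis reach_valsI right.simps(2))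
  qed
next
  case (Suc n)
  let ?x = "Matched u v (Suc n)"
  show ?case
  proof
    fix X assume "X \<in> reach_vals N (insert p Q) v"
    then obtain w where w: "(v, w) \<in> reach N" "X = val N w \<inter> insert p Q"
      by (auto simp: reach_vals_def)
    from w(1) obtain v' where v': "(v, v') \<in> (\<Union>i. rel N i)" "v' = w \<or> (v', w) \<in> reach N"
      by (metis converse_tranclE)
    then obtain i where "(v, v') \<in> rel N i"
      by blast
    then obtain u' where i: "(?x, Matched u' v' n) \<in> rel amalg i"
      using matched_step_right[OF Suc.prems, of v' "Coalition {i}"] by (auto simp: rel_D_single)
    then have r: "(?x, Matched u' v' n) \<in> reach amalg" and y: "is_world (Matched u' v' n)"
      by (blast, simp add: rel_amalg)
    show "X \<in> reach_vals amalg (insert p Q) ?x"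
      using v'(2)
    proof
      assume "v' = w"
      then show ?thesis
        using val_right[OF y] w(2) r by (metis reach_valsI right.simps(1))
    next
      assume "(v', w) \<in> reach N"
      then have "X \<in> reach_vals N (insert p Q) v'"
        using w(2) by (auto simp: reach_vals_def)
      then show ?thesis
        using Suc.IH[OF y] reach_vals_mono[OF r] by blast
    qed
  qed
qed

lemma reach_vals_matched:
  assumes "is_world (Matched u v n)"
  shows "reach_vals amalg (insert p Q) (Matched u v n) = reach_vals N (insert p Q) v"
proof
  show "reach_vals amalg (insert p Q) (Matched u v n) \<subseteq> reach_vals N (insert p Q) v"
  proof
    fix X assume "X \<in> reach_vals amalg (insert p Q) (Matched u v n)"
    then obtain y where y: "(Matched u v n, y) \<in> reach amalg" "X = val amalg y \<inter> insert p Q"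
      by (auto simp: reach_vals_def)
    then have "is_world y"
      using reach_worlds[OF is_model_amalg[OF assms] y(1)] by simp
    then show "X \<in> reach_vals N (insert p Q) v"
      using val_right y reach_amalg_right[OF y(1)] by (auto simp: reach_vals_def)
  qed
qed (rule reach_vals_matched_subset[OF assms])

text \<open>The premise on \<open>f\<close> covers all indices from \<open>m\<close> on, since an
  edge from index \<open>Suc m\<close> may lead to any of them. Free worlds are entered from matched
  pairs only at index 0.\<close>

lemma sat_Dist_matched:
  assumes x: "is_world (Matched u v (Suc m))"
    and f: "\<And>u v n. is_world (Matched u v n) \<Longrightarrow> m \<le> n \<Longrightarrow> sat amalg (Matched u v n) f \<longleftrightarrow> sat N v f"
  shows "sat amalg (Matched u v (Suc m)) (Dist B f) \<longleftrightarrow> sat N v (Dist B f)"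
proof
  assume *: "sat amalg (Matched u v (Suc m)) (Dist B f)"
  have "sat N v' f" if v': "(v, v') \<in> rel_D N B" for v'
  proof -
    obtain u' where "(Matched u v (Suc m), Matched u' v' m) \<in> rel_D amalg B"
      using matched_step_right[OF x v'] by blast
    with * f[of u' v' m] show ?thesis
      by (auto simp: rel_D_amalg)
  qed
  then show "sat N v (Dist B f)"
    by simp
next
  assume *: "sat N v (Dist B f)"
  have "sat amalg y f" if y: "(Matched u v (Suc m), y) \<in> rel_D amalg B" for y
  proof -
    have "y \<noteq> Free u' w' v'" for u' w' v'
      using y members[of B] by (auto simp: rel_D_amalg)
    then obtain u' v' n where y': "y = Matched u' v' n"
      by (cases y) auto
    then have "\<forall>i\<in>members B. (v, v') \<in> rel N i \<and> m \<le> n"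
      using y by (simp add: rel_D_amalg)
    then have "(v, v') \<in> rel_D N B" "m \<le> n"
      using members[of B] by (auto simp: rel_D_def)
    then show ?thesis
      using * f[of u' v' n] y unfolding y' by (auto simp: rel_D_amalg)
  qed
  then show "sat amalg (Matched u v (Suc m)) (Dist B f)"
    by simp
qed

lemma sat_amalg_right:
  "is_world (Matched u v n) \<Longrightarrow> atoms f \<subseteq> insert p Q \<Longrightarrow> depth f \<le> n \<Longrightarrow>
    sat amalg (Matched u v n) f \<longleftrightarrow> sat N v f"
proof (induction f arbitrary: u v n)
  case (Atom q)
  then show ?case
    using val_right[OF Atom.prems(1)] by auto
next
  case (Know i f)
  then obtain m where "n = Suc m" "depth f \<le> m"
    by (auto dest: Suc_le_D)
  with Know show ?case
    unfolding sat_Know_Dist by (auto intro!: sat_Dist_matched simp del: sat.simps)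
next
  case (Dist B f)
  then obtain m where "n = Suc m" "depth f \<le> m"
    by (auto dest: Suc_le_D)
  with Dist show ?case
    by (auto intro!: sat_Dist_matched simp del: sat.simps)
next
  case (Common f)
  then have "atoms_prop f \<subseteq> insert p Q"
    by simp
  from sat_Common_reach_vals[OF this] show ?case
    using reach_vals_matched[OF Common.prems(1)] by metis
qed auto

section \<open>Seriality and reflexivity of the amalgam\<close>

lemma amalg_DnDPC:
  assumes "is_world x" "M \<in> DnDPC"
  shows "amalg \<in> DnDPC"
proof -
  have "\<exists>z. (y, z) \<in> rel amalg i" if y: "is_world y" for y i
  proof -
    have "left y \<in> worlds M"
      using y by (cases y) auto
    then obtain u where "(left y, u) \<in> rel M i"
      using assms(2) by (auto simp: DnDPC_def)
    then show ?thesis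
      using left_back[OF y, of u "Coalition {i}"] by (auto simp: rel_D_single)
  qed
  then show ?thesis
    using is_model_amalg[OF assms(1)] by (simp add: DnDPC_def)
qed

text \<open>A loop keeps the index or the exit point, which \<open>right_step\<close> permits; at
  matched pairs it also uses reflexivity of \<open>N\<close>.\<close>

lemma amalg_TnDPC:
  assumes "is_world x" "M \<in> TnDPC" "N \<in> TnDPC"
  shows "amalg \<in> TnDPC"
proof -
  have "(y, y) \<in> rel amalg i" if y: "is_world y" for y i
    using y assms(2,3) by (cases y) (auto simp: rel_amalg TnDPC_def refl_on_def)
  then show ?thesis
    using is_model_amalg[OF assms(1)] by (auto simp: TnDPC_def refl_on_def rel_amalg)
qed

end

section \<open>The interpolant\<close>

lemma amalgamation:
  fixes M N :: "('s, 'a :: finite, 'p :: countable) model"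
  assumes inf: "infinite (UNIV :: 's set)"
    and L: "L = KnDPC \<or> L = DnDPC \<or> L = TnDPC"
    and inM: "M \<in> L" "u \<in> worlds M" and inN: "N \<in> L" "v \<in> worlds N"
    and Q: "finite Q" "p \<notin> Q" and agr: "agree Q n M u N v"
  shows "\<exists>K\<in>L. \<exists>s\<in>worlds K. (\<forall>h. p \<notin> atoms h \<longrightarrow> (sat K s h \<longleftrightarrow> sat M u h)) \<and>
    (\<forall>f. atoms f \<subseteq> insert p Q \<and> depth f \<le> n \<longrightarrow> (sat K s f \<longleftrightarrow> sat N v f))"
proof -
  have m: "is_model M" "is_model N"
    using L inM(1) inN(1) by (auto simp: KnDPC_def DnDPC_def TnDPC_def)
  interpret amalgam M N Q p
    using m Q by unfold_locales
  let ?x = "Matched u v n"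
  have x: "is_world ?x"
    using inM(2) inN(2) agr by simp
  \<comment> \<open>The worlds of the amalgam have a different type; downward Loewenheim-Skolem
    brings the model back to \<open>'s\<close>.\<close>
  obtain K :: "('s, 'a, 'p) model" and s where K: "s \<in> worlds K" "\<And>f. sat K s f \<longleftrightarrow> sat amalg ?x f"
    "K \<in> KnDPC" "amalg \<in> DnDPC \<longrightarrow> K \<in> DnDPC" "amalg \<in> TnDPC \<longrightarrow> K \<in> TnDPC"
    using transfer_model[OF inf is_model_amalg[OF x], of ?x] x by auto
  have "K \<in> L"
    using L inM(1) inN(1) K(3-5) amalg_DnDPC[OF x] amalg_TnDPC[OF x] by blast
  then show ?thesis
    using K(1,2) sat_amalg_left[OF x] sat_amalg_right[OF x] by (intro bexI[of _ K] bexI[of _ s]) auto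
qed

lemma uniform_interpolation_DPC:
  fixes L :: "('s, 'a :: finite, 'p :: countable) model set"
  assumes inf: "infinite (UNIV :: 's set)"
    and L: "L = KnDPC \<or> L = DnDPC \<or> L = TnDPC"
  shows "uniform_interpolation L"
  unfolding uniform_interpolation_def
proof (intro allI impI)
  fix P :: "'p set" and f :: "('a, 'p) fm" and p :: 'p
  assume "finite P \<and> satisfiable L f \<and> atoms f \<subseteq> P \<and> p \<in> P"
  then have P: "finite P" "satisfiable L f" "atoms f \<subseteq> P" "p \<in> P"
    by auto
  define Q where "Q = P - {p}"
  have Q: "finite Q" "p \<notin> Q" "insert p Q = P"
    using P by (auto simp: Q_def)
  define S :: "('a, 'p) fm set" where "S = probes Q (depth f)"
  have S: "finite S"
    using finite_probes[OF Q(1)] by (simp add: S_def)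
  \<comment> \<open>These are the types over \<open>Q\<close> realised together with
    \<open>f\<close>. There are finitely many because each is a subset of \<open>S\<close>.\<close>
  define T where "T = {{h \<in> S. sat N v h} | N v. N \<in> L \<and> v \<in> worlds N \<and> sat N v f}"
  have T: "T \<subseteq> Pow S"
    by (auto simp: T_def)
  then have finT: "finite T"
    using S by (simp add: finite_subset)
  define g where "g = Disj (desc S ` T)"
  have sat_g: "sat M u g \<longleftrightarrow> {h \<in> S. sat M u h} \<in> T" for M :: "('s, 'a, 'p) model" and u
  proof -
    have "sat M u g \<longleftrightarrow> (\<exists>A\<in>T. sat M u (desc S A))"
      using finT by (simp add: g_def sat_Disj)
    also have "\<dots> \<longleftrightarrow> (\<exists>A\<in>T. {h \<in> S. sat M u h} = A)"
      using T by (intro bex_cong) (auto simp: sat_desc[OF S])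
    finally show ?thesis
      by simp
  qed
  have f_g: "sat M u g" if "M \<in> L" "u \<in> worlds M" "sat M u f" for M u
    using that unfolding sat_g T_def by blast
  have "satisfiable L g"
    using P(2) f_g unfolding satisfiable_def by blast
  moreover have "atoms g \<subseteq> P - {p}"
  proof -
    have "atoms (desc S A) \<subseteq> Q" if "A \<in> T" for A
      using atoms_desc[OF S, of A] that T atoms_probes[OF Q(1)] unfolding S_def by blast
    then show ?thesis
      using finT by (auto simp: g_def atoms_Disj Q_def)
  qed
  moreover have "entails L f h \<longleftrightarrow> entails L g h" if h: "p \<notin> atoms h" for h
  proof
    assume "entails L g h"
    then show "entails L f h"
      using f_g unfolding entails_def by blast
  next
    assume fh: "entails L f h"
    have "sat M u h" if M: "M \<in> L" "u \<in> worlds M" "sat M u g" for M u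
    proof -
      from M(3) obtain N v where N: "N \<in> L" "v \<in> worlds N" "sat N v f"
        and eq: "{h \<in> S. sat M u h} = {h \<in> S. sat N v h}"
        unfolding sat_g T_def by blast
      have "agree Q (depth f) M u N v"
        using eq unfolding agree_def S_def by blast
      \<comment> \<open>At \<open>s\<close>, \<open>K\<close> inherits \<open>f\<close> from
        \<open>N\<close>, so \<open>h\<close> holds there by \<open>fh\<close>; as \<open>h\<close>
        avoids \<open>p\<close>, it passes on to \<open>M\<close>.\<close>
      from amalgamation[OF inf L M(1,2) N(1,2) Q(1,2) this] obtain K s
        where K: "K \<in> L" "s \<in> worlds K" "sat K s h \<longleftrightarrow> sat M u h" "sat K s f \<longleftrightarrow> sat N v f"
        using h P(3) Q(3) by blast
      then show ?thesis
        using fh N(3) unfolding entails_def by blast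
    qed
    then show "entails L g h"
      unfolding entails_def by blast
  qed
  ultimately show "\<exists>g. satisfiable L g \<and> atoms g \<subseteq> P - {p} \<and>
      (\<forall>h. p \<notin> atoms h \<longrightarrow> (entails L f h \<longleftrightarrow> entails L g h))"
    by blast
qed

theorem theorem6p12:
  assumes "infinite (UNIV :: 's set)"
  shows "uniform_interpolation (KnDPC :: ('s, 'a :: finite, 'p :: countable) model set) \<and>
    uniform_interpolation (DnDPC :: ('s, 'a, 'p) model set) \<and>
    uniform_interpolation (TnDPC :: ('s, 'a, 'p) model set)"
  using uniform_interpolation_DPC[OF assms] by blast

end
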